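(* Let $k$ be a field containing the rational numbers and let $(\mathcal{A},\mu,\alpha)$ be a multiplicative Hom-associative algebra over $k$. Then $HC^n_{Hom,\lambda}(\mathcal{A})\cong HC^n_{Hom}(\mathcal{A})$ for all $n\ge 0$, i.e. the cohomology of the cyclic subcomplex $(C^\ast_{\lambda,Hom}(\mathcal{A},\mathcal{A}^\ast),b)$ agrees with the total cohomology of the cocyclic bicomplex $CC^{\ast,\ast}_{Hom}(\mathcal{A})$.
   Context: A Hom-associative algebra $(\mathcal{A},\mu,\alpha)$ over a field $k$ is a $k$-vector space $\mathcal{A}$ with linear maps $\mu:\mathcal{A}\otimes\mathcal{A}\to\mathcal{A}$, written $ab$, and $\alpha:\mathcal{A}\to\mathcal{A}$ such that $\alpha(a)(bc)=(ab)\alpha(c)$. It is multiplicative if $\alpha(ab)=\alpha(a)\alpha(b)$. No unit is assumed. Let $C^n$ be the space of linear maps $\phi:\mathcal{A}^{\otimes (n+1)}\to k$ (identified with $C^n_{Hom}(\mathcal{A},\mathcal{A}^\ast)=\mathrm{Hom}(\mathcal{A}^{\otimes n},\mathcal{A}^\ast)$ via $\phi(a_0\otimes\cdots\otimes a_n)=\varphi(a_1\otimes\cdots\otimes a_n)(a_0)$). Define $b,b':C^n\to C^{n+1}$ by $$b'\phi(a_0\otimes\cdots\otimes a_{n+1})=\sum_{i=0}^{n}(-1)^i\phi(\alpha(a_0)\otimes\cdots\otimes a_ia_{i+1}\otimes\cdots\otimes\alpha(a_{n+1})),$$ $$b\phi(a_0\otimes\cdots\otimes a_{n+1})=b'\phi(a_0\otimes\cdots\otimes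 a_{n+1})+(-1)^{n+1}\phi(a_{n+1}a_0\otimes\alpha(a_1)\otimes\cdots\otimes\alpha(a_n)),$$ and $t_n,N:C^n\to C^n$ by $t_n\phi(a_0\otimes\cdots\otimes a_n)=(-1)^n\phi(a_n\otimes a_0\otimes\cdots\otimes a_{n-1})$, $N=\mathrm{Id}+t_n+\cdots+t_n^n$. $C^n_{\lambda,Hom}(\mathcal{A},\mathcal{A}^\ast)=\ker(\mathrm{Id}-t_n)\subseteq C^n$; it is preserved by $b$, and $HC^\ast_{Hom,\lambda}(\mathcal{A})$ is the cohomology of $(C^\ast_{\lambda,Hom}(\mathcal{A},\mathcal{A}^\ast),b)$. The cocyclic bicomplex has $CC^{p,q}_{Hom}(\mathcal{A})=C^q$ for $p,q\ge 0$; the vertical differential $CC^{p,q}\to CC^{p,q+1}$ is $b$ for $p$ even and $-b'$ for $p$ odd; the horizontal differential $CC^{p,q}\to CC^{p+1,q}$ is $\mathrm{Id}-t_q$ for $p$ even and $N$ for $p$ odd. $HC^\ast_{Hom}(\mathcal{A})$ is the cohomology of its total complex, $\mathrm{Tot}^n=\bigoplus_{p+q=n}CC^{p,q}$ with differential the sum of the horizontal and vertical ones. *)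

theory Defs
  imports Complex_Main "HOL-Library.Function_Algebras" "HOL-Library.Set_Algebras"
begin

text \<open>
  The cohomology of a cochain complex at degree \<open>n\<close> depends on \<open>n\<close> and on the algebra, hence it is
  represented as a vector space with an explicit carrier.
\<close>

record ('k, 'v) vspace =
  vcarrier :: "'v set"
  vadd :: "'v \<Rightarrow> 'v \<Rightarrow> 'v"
  vsmult :: "'k \<Rightarrow> 'v \<Rightarrow> 'v"

definition vspace_isomorphic :: "('k, 'v) vspace \<Rightarrow> ('k, 'w) vspace \<Rightarrow> bool" where
  "vspace_isomorphic V W \<longleftrightarrow>
     (\<exists>f. bij_betw f (vcarrier V) (vcarrier W) \<and>
          (\<forall>x\<in>vcarrier V. \<forall>y\<in>vcarrier V. f (vadd V x y) = vadd W (f x) (f y)) \<and>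
          (\<forall>c. \<forall>x\<in>vcarrier V. f (vsmult V c x) = vsmult W c (f x)))"

text \<open>
  The quotient \<open>Z / B\<close> of subspaces \<open>B \<subseteq> Z\<close> of a vector space with scalar multiplication \<open>scale\<close>.
  Elements are cosets \<open>z +o B\<close> and \<open>+\<close> on sets is the elementwise (Minkowski) sum. In the scalar
  multiplication, adding \<open>B\<close> matters only for the scalar \<open>0\<close>, where the image alone is \<open>{0}\<close>
  instead of \<open>B\<close>.
\<close>

definition quotient_vspace ::
    "('k \<Rightarrow> 'v \<Rightarrow> 'v) \<Rightarrow> 'v set \<Rightarrow> 'v set \<Rightarrow> ('k, ('v::ab_group_add) set) vspace" where
  "quotient_vspace scale Z B =
     \<lparr> vcarrier = (\<lambda>z. z +o B) ` Z,
       vadd = (\<lambda>X Y. X + Y),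
       vsmult = (\<lambda>c X. scale c ` X + B) \<rparr>"

lemma (in module) vadd_coset:
  assumes "subspace B"
  shows "vadd (quotient_vspace scale Z B) (x +o B) (y +o B) = (x + y) +o B"
proof -
  have "B + B = B"
    using assms unfolding subspace_def set_plus_def by force
  then show ?thesis
    by (simp add: quotient_vspace_def set_plus_rearrange)
qed

lemma (in module) vsmult_coset:
  assumes "subspace B"
  shows "vsmult (quotient_vspace scale Z B) c (x +o B) = (c *s x) +o B"
proof -
  have "(*s) c ` (x +o B) = (c *s x) +o ((*s) c ` B)"
    unfolding elt_set_plus_def by (force simp: scale_right_distrib)
  moreover have "(*s) c ` B + B = B"
  proof
    show "(*s) c ` B + B \<subseteq> B"
      using assms unfolding subspace_def set_plus_def by auto
    have "0 \<in> (*s) c ` B"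
      using assms unfolding subspace_def by (metis image_eqI scale_zero_right)
    then show "B \<subseteq> (*s) c ` B + B"
      by (rule set_zero_plus2)
  qed
  ultimately show ?thesis
    by (simp add: quotient_vspace_def set_plus_rearrange3)
qed

definition cocycles :: "(nat \<Rightarrow> 'v set) \<Rightarrow> (nat \<Rightarrow> 'v \<Rightarrow> 'v) \<Rightarrow> nat \<Rightarrow> ('v::zero) set" where
  "cocycles C d n = {x \<in> C n. d n x = 0}"

definition coboundaries :: "(nat \<Rightarrow> 'v set) \<Rightarrow> (nat \<Rightarrow> 'v \<Rightarrow> 'v) \<Rightarrow> nat \<Rightarrow> ('v::zero) set" where
  "coboundaries C d n = (case n of 0 \<Rightarrow> {0} | Suc m \<Rightarrow> d m ` C m)"

definition cohomology ::
    "('k \<Rightarrow> 'v \<Rightarrow> 'v) \<Rightarrow> (nat \<Rightarrow> 'v set) \<Rightarrow> (nat \<Rightarrow> 'v \<Rightarrow> 'v) \<Rightarrow> nat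
       \<Rightarrow> ('k, ('v::ab_group_add) set) vspace" where
  "cohomology scale C d n = quotient_vspace scale (cocycles C d n) (coboundaries C d n)"

text \<open>
  A bicomplex is given by spaces \<open>CC p q\<close>, horizontal maps \<open>h p q : CC p q \<rightarrow> CC (p + 1) q\<close> and
  vertical maps \<open>v p q : CC p q \<rightarrow> CC p (q + 1)\<close>. An element \<open>w\<close> of the direct sum of the \<open>CC p q\<close>
  with \<open>p + q = n\<close> is the family of its components \<open>w p \<in> CC p (n - p)\<close>, padded with \<open>0\<close> for \<open>p > n\<close>.
\<close>

definition tot_space :: "(nat \<Rightarrow> nat \<Rightarrow> 'v set) \<Rightarrow> nat \<Rightarrow> (nat \<Rightarrow> 'v::zero) set" where
  "tot_space CC n = {w. (\<forall>p\<le>n. w p \<in> CC p (n - p)) \<and> (\<forall>p>n. w p = 0)}"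

definition tot_diff ::
    "(nat \<Rightarrow> nat \<Rightarrow> 'v \<Rightarrow> 'v) \<Rightarrow> (nat \<Rightarrow> nat \<Rightarrow> 'v \<Rightarrow> 'v) \<Rightarrow> nat
       \<Rightarrow> (nat \<Rightarrow> 'v) \<Rightarrow> nat \<Rightarrow> 'v::monoid_add" where
  "tot_diff h v n w =
     (\<lambda>p. (if 1 \<le> p \<and> p \<le> n + 1 then h (p - 1) (n - (p - 1)) (w (p - 1)) else 0)
        + (if p \<le> n then v p (n - p) (w p) else 0))"

locale hom_associative_algebra = vector_space scale
  for scale :: "'k::field \<Rightarrow> 'a::ab_group_add \<Rightarrow> 'a" +
  fixes mu :: "'a \<Rightarrow> 'a \<Rightarrow> 'a"
    and \<alpha> :: "'a \<Rightarrow> 'a"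
  assumes linear_mu_right: "Vector_Spaces.linear scale scale (\<lambda>y. mu x y)"
    and linear_mu_left: "Vector_Spaces.linear scale scale (\<lambda>x. mu x y)"
    and linear_alpha: "Vector_Spaces.linear scale scale \<alpha>"
    and hom_assoc: "mu (\<alpha> x) (mu y z) = mu (mu x y) (\<alpha> z)"

locale multiplicative_hom_associative_algebra = hom_associative_algebra +
  assumes alpha_mult: "\<alpha> (mu x y) = mu (\<alpha> x) (\<alpha> y)"

text \<open>
  A linear form on the \<open>(n + 1)\<close>-fold tensor power of the algebra is represented by the
  corresponding multilinear form \<open>\<phi> [a\<^sub>0, \<dots>, a\<^sub>n]\<close> on lists of length \<open>n + 1\<close>; it is extended by \<open>0\<close>
  to lists of any other length, so that equality of cochains is equality of functions.
\<close>

definition cochains ::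
    "('k::field \<Rightarrow> 'a::ab_group_add \<Rightarrow> 'a) \<Rightarrow> nat \<Rightarrow> ('a list \<Rightarrow> 'k) set" where
  "cochains scale n =
     {\<phi>. (\<forall>as. length as \<noteq> n + 1 \<longrightarrow> \<phi> as = 0) \<and>
         (\<forall>as. length as = n + 1 \<longrightarrow>
            (\<forall>i\<le>n. Vector_Spaces.linear scale (*) (\<lambda>x. \<phi> (as[i := x]))))}"

definition scale_cochain :: "'k \<Rightarrow> ('a list \<Rightarrow> 'k) \<Rightarrow> 'a list \<Rightarrow> 'k::field" where
  "scale_cochain c \<phi> = (\<lambda>as. c * \<phi> as)"

definition hom_b' ::
    "('a \<Rightarrow> 'a \<Rightarrow> 'a) \<Rightarrow> ('a \<Rightarrow> 'a) \<Rightarrow> nat \<Rightarrow> ('a list \<Rightarrow> 'k) \<Rightarrow> 'a list \<Rightarrow> 'k::field" where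
  "hom_b' mu \<alpha> n \<phi> =
     (\<lambda>as. if length as = n + 2 then
             (\<Sum>i\<le>n. (-1) ^ i *
                \<phi> (map \<alpha> (take i as) @ [mu (as ! i) (as ! (i + 1))] @ map \<alpha> (drop (i + 2) as)))
           else 0)"

definition hom_b ::
    "('a \<Rightarrow> 'a \<Rightarrow> 'a) \<Rightarrow> ('a \<Rightarrow> 'a) \<Rightarrow> nat \<Rightarrow> ('a list \<Rightarrow> 'k) \<Rightarrow> 'a list \<Rightarrow> 'k::field" where
  "hom_b mu \<alpha> n \<phi> =
     (\<lambda>as. if length as = n + 2 then
             hom_b' mu \<alpha> n \<phi> as +
             (-1) ^ (n + 1) * \<phi> (mu (as ! (n + 1)) (as ! 0) # map \<alpha> (take n (drop 1 as)))
           else 0)"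

definition cyc_t :: "nat \<Rightarrow> ('a list \<Rightarrow> 'k) \<Rightarrow> 'a list \<Rightarrow> 'k::field" where
  "cyc_t n \<phi> = (\<lambda>as. if length as = n + 1 then (-1) ^ n * \<phi> (last as # butlast as) else 0)"

definition cyc_N :: "nat \<Rightarrow> ('a list \<Rightarrow> 'k) \<Rightarrow> 'a list \<Rightarrow> 'k::field" where
  "cyc_N n \<phi> = (\<Sum>j\<le>n. (cyc_t n ^^ j) \<phi>)"

definition cyclic_cochains ::
    "('k::field \<Rightarrow> 'a::ab_group_add \<Rightarrow> 'a) \<Rightarrow> nat \<Rightarrow> ('a list \<Rightarrow> 'k) set" where
  "cyclic_cochains scale n = {\<phi> \<in> cochains scale n. \<phi> - cyc_t n \<phi> = 0}"

definition HC_lambda ::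
    "('k::field \<Rightarrow> 'a::ab_group_add \<Rightarrow> 'a) \<Rightarrow> ('a \<Rightarrow> 'a \<Rightarrow> 'a) \<Rightarrow> ('a \<Rightarrow> 'a) \<Rightarrow> nat
       \<Rightarrow> ('k, ('a list \<Rightarrow> 'k) set) vspace" where
  "HC_lambda scale mu \<alpha> n = cohomology scale_cochain (cyclic_cochains scale) (hom_b mu \<alpha>) n"

definition CC_hor :: "nat \<Rightarrow> nat \<Rightarrow> ('a list \<Rightarrow> 'k) \<Rightarrow> 'a list \<Rightarrow> 'k::field" where
  "CC_hor p q \<phi> = (if even p then \<phi> - cyc_t q \<phi> else cyc_N q \<phi>)"

definition CC_ver ::
    "('a \<Rightarrow> 'a \<Rightarrow> 'a) \<Rightarrow> ('a \<Rightarrow> 'a) \<Rightarrow> nat \<Rightarrow> nat \<Rightarrow> ('a list \<Rightarrow> 'k) \<Rightarrow> 'a list \<Rightarrow> 'k::field" where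
  "CC_ver mu \<alpha> p q \<phi> = (if even p then hom_b mu \<alpha> q \<phi> else - hom_b' mu \<alpha> q \<phi>)"

definition HC ::
    "('k::field \<Rightarrow> 'a::ab_group_add \<Rightarrow> 'a) \<Rightarrow> ('a \<Rightarrow> 'a \<Rightarrow> 'a) \<Rightarrow> ('a \<Rightarrow> 'a) \<Rightarrow> nat
       \<Rightarrow> ('k, (nat \<Rightarrow> 'a list \<Rightarrow> 'k) set) vspace" where
  "HC scale mu \<alpha> n =
     cohomology (\<lambda>c w p. scale_cochain c (w p))
       (tot_space (\<lambda>p q. cochains scale q))
       (tot_diff CC_hor (CC_ver mu \<alpha>)) n"

end

theory Submission
  imports Defs
begin

text \<open>
  Over a field of characteristic \<open>0\<close> the rows of the bicomplex are exact in positive columns, because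
  \<open>t\<close> generates an action of a finite cyclic group of order \<open>n + 1\<close> on the \<open>n\<close>-cochains. In column \<open>0\<close> the
  kernel of the horizontal differential consists of the cyclic cochains. Removing the components of a
  total cochain from the highest column downwards then makes the inclusion of column \<open>0\<close> a
  quasi-isomorphism. The bicomplex identities reduce to the relations \<open>d\<^sub>i d\<^sub>j = d\<^sub>j\<^sub>-\<^sub>1 d\<^sub>i\<close> for \<open>i < j\<close>
  between the faces and \<open>d\<^sub>i \<circ> rot = rot \<circ> d\<^sub>i\<^sub>-\<^sub>1\<close>, \<open>d\<^sub>0 \<circ> rot = d\<^sub>n\<^sub>+\<^sub>1\<close>; multiplicativity of \<open>\<alpha>\<close> enters only in
  the first one.
\<close>

section \<open>Quotient spaces\<close>

lemma (in module) coset_eq_iff: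
  assumes "subspace B"
  shows "x +o B = y +o B \<longleftrightarrow> x - y \<in> B"
proof
  assume "x +o B = y +o B"
  moreover have "x + 0 \<in> x +o B"
    using assms by (intro set_plus_intro2 subspace_0)
  ultimately have "x \<in> y +o B"
    by simp
  then show "x - y \<in> B"
    by (auto simp: elt_set_plus_def)
next
  assume *: "x - y \<in> B"
  have "x + b \<in> y +o B" if "b \<in> B" for b
    using subspace_add[OF assms * that] by (auto simp: elt_set_plus_def algebra_simps intro!: bexI)
  moreover have "y + b \<in> x +o B" if "b \<in> B" for b
    using subspace_diff[OF assms that *] by (auto simp: elt_set_plus_def algebra_simps intro!: bexI)
  ultimately show "x +o B = y +o B"
    by (auto simp: elt_set_plus_def)
qed

text \<open>The equivalence \<open>inj\<close> yields well-definedness and injectivity at once, and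
  surjectivity is asked only modulo \<open>B'\<close>.\<close>

lemma (in module_hom) vspace_isomorphic_quotient:
  assumes B: "m1.subspace B" "B \<subseteq> Z" and Z: "m1.subspace Z" and B': "m2.subspace B'"
    and maps: "\<And>x. x \<in> Z \<Longrightarrow> f x \<in> Z'"
    and inj: "\<And>x. x \<in> Z \<Longrightarrow> f x \<in> B' \<longleftrightarrow> x \<in> B"
    and surj: "\<And>y. y \<in> Z' \<Longrightarrow> \<exists>x\<in>Z. y - f x \<in> B'"
  shows "vspace_isomorphic (quotient_vspace s1 Z B) (quotient_vspace s2 Z' B')"
proof -
  \<comment> \<open>The image of a coset of \<open>B\<close> may be only part of a coset of
    \<open>B'\<close>; adding \<open>B'\<close> completes it, so no representative has to be
    chosen.\<close>
  define F where "F X = f ` X + B'" for X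
  have fB: "f ` B + B' = B'"
  proof
    show "f ` B + B' \<subseteq> B'"
      using B inj by (auto simp: set_plus_def subset_iff intro!: m2.subspace_add[OF B'])
    show "B' \<subseteq> f ` B + B'"
      using m1.subspace_0[OF B(1)] by (intro set_zero_plus2) (metis image_eqI zero)
  qed
  have F: "F (x +o B) = f x +o B'" for x
  proof -
    have "f ` (x +o B) = f x +o f ` B"
      by (force simp: elt_set_plus_def add)
    then show ?thesis
      by (simp add: F_def set_plus_rearrange3 fB)
  qed
  let ?V = "quotient_vspace s1 Z B" and ?W = "quotient_vspace s2 Z' B'"
  have V: "vcarrier ?V = (\<lambda>z. z +o B) ` Z" and W: "vcarrier ?W = (\<lambda>z. z +o B') ` Z'"
    by (simp_all add: quotient_vspace_def)
  have "inj_on F (vcarrier ?V)"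
    using inj m1.subspace_diff[OF Z] unfolding V
    by (auto simp: inj_on_def F m1.coset_eq_iff[OF B(1)] m2.coset_eq_iff[OF B'] simp flip: diff)
  moreover have "F ` vcarrier ?V = vcarrier ?W"
  proof
    show "F ` vcarrier ?V \<subseteq> vcarrier ?W"
      using maps unfolding V W by (auto simp: F)
    show "vcarrier ?W \<subseteq> F ` vcarrier ?V"
    proof
      fix Y assume "Y \<in> vcarrier ?W"
      then obtain y where y: "y \<in> Z'" "Y = y +o B'"
        unfolding W by auto
      then obtain x where x: "x \<in> Z" "y - f x \<in> B'"
        using surj by blast
      then have "Y = F (x +o B)"
        using y by (simp add: F m2.coset_eq_iff[OF B'])
      with x show "Y \<in> F ` vcarrier ?V"
        unfolding V by blast
    qed
  qed
  moreover have "F (vadd ?V X Y) = vadd ?W (F X) (F Y)"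
    if "X \<in> vcarrier ?V" "Y \<in> vcarrier ?V" for X Y
    using that unfolding V by (auto simp: F m1.vadd_coset[OF B(1)] m2.vadd_coset[OF B'] add)
  moreover have "F (vsmult ?V c X) = vsmult ?W c (F X)" if "X \<in> vcarrier ?V" for c X
    using that unfolding V by (auto simp: F m1.vsmult_coset[OF B(1)] m2.vsmult_coset[OF B'] scale)
  ultimately show ?thesis
    unfolding vspace_isomorphic_def bij_betw_def by (intro exI[of _ F] conjI ballI allI)
qed

lemma module_fun:
  assumes "module scale"
  shows "module (\<lambda>c (w :: 'i \<Rightarrow> _) i. scale c (w i))"
proof -
  interpret module scale by fact
  show ?thesis
    by unfold_locales (auto simp: algebra_simps)
qed


section \<open>Bicomplexes with exact rows\<close>

text \<open>Since squares anticommute, the total differential is a plain sum. Exactness starts at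
  column \<open>Suc p\<close>, so the row kernels in column 0 can carry the cohomology. The maps are
  linear on the whole type because cochains of all degrees share it.\<close>

locale row_exact_bicomplex = module scale
  for scale :: "'k::comm_ring_1 \<Rightarrow> 'v::ab_group_add \<Rightarrow> 'v" +
  fixes CC :: "nat \<Rightarrow> nat \<Rightarrow> 'v set"
    and h v :: "nat \<Rightarrow> nat \<Rightarrow> 'v \<Rightarrow> 'v"
  assumes subspace_CC: "subspace (CC p q)"
    and hom_h: "module_hom scale scale (h p q)"
    and hom_v: "module_hom scale scale (v p q)"
    and h_in: "x \<in> CC p q \<Longrightarrow> h p q x \<in> CC (Suc p) q"
    and v_in: "x \<in> CC p q \<Longrightarrow> v p q x \<in> CC p (Suc q)"
    and h_h: "x \<in> CC p q \<Longrightarrow> h (Suc p) q (h p q x) = 0"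
    and v_v: "x \<in> CC p q \<Longrightarrow> v p (Suc q) (v p q x) = 0"
    and h_v: "x \<in> CC p q \<Longrightarrow> h p (Suc q) (v p q x) + v (Suc p) q (h p q x) = 0"
    and row_exact: "x \<in> CC (Suc p) q \<Longrightarrow> h (Suc p) q x = 0 \<Longrightarrow> \<exists>y\<in>CC p q. x = h p q y"
begin

section \<open>The total complex\<close>

abbreviation tot_scale :: "'k \<Rightarrow> (nat \<Rightarrow> 'v) \<Rightarrow> nat \<Rightarrow> 'v" where
  "tot_scale \<equiv> \<lambda>c w p. scale c (w p)"

abbreviation Tot :: "nat \<Rightarrow> (nat \<Rightarrow> 'v) set" where
  "Tot \<equiv> tot_space CC"

abbreviation D :: "nat \<Rightarrow> (nat \<Rightarrow> 'v) \<Rightarrow> nat \<Rightarrow> 'v" where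
  "D \<equiv> tot_diff h v"

sublocale tot: module tot_scale
  by (rule module_fun) (rule module_axioms)

sublocale h: module_hom scale scale "h p q" for p q
  by (rule hom_h)

sublocale v: module_hom scale scale "v p q" for p q
  by (rule hom_v)

sublocale D: module_hom tot_scale tot_scale "D n" for n
proof
  show "D n (w + w') = D n w + D n w'" for w w'
    by (auto simp: tot_diff_def h.add v.add fun_eq_iff)
  show "D n (tot_scale c w) = tot_scale c (D n w)" for c w
    by (auto simp: tot_diff_def h.scale v.scale scale_right_distrib fun_eq_iff)
qed

lemma subspace_Tot: "tot.subspace (Tot n)"
  unfolding tot.subspace_def tot_space_def
  by (auto intro: subspace_0 subspace_add subspace_scale subspace_CC)

text \<open>For \<open>p > n\<close> the padding 0 lies in every subspace, so truncated subtraction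
  does no harm and later arguments need no bound on \<open>p\<close>.\<close>

lemma Tot_nth: "w \<in> Tot n \<Longrightarrow> w p \<in> CC p (n - p)"
  using subspace_0[OF subspace_CC] by (cases "p \<le> n") (auto simp: tot_space_def)

lemma Tot_vanish: "w \<in> Tot n \<Longrightarrow> n < p \<Longrightarrow> w p = 0"
  by (auto simp: tot_space_def)

lemma D_0: "D n w 0 = v 0 n (w 0)"
  by (simp add: tot_diff_def)

text \<open>Where a guard of \<open>tot_diff\<close> fails, the component of \<open>w\<close>
  concerned is already 0 and the linear map kills it.\<close>

lemma D_Suc:
  assumes "w \<in> Tot n"
  shows "D n w (Suc p) = h p (n - p) (w p) + v (Suc p) (n - Suc p) (w (Suc p))"
  using Tot_vanish[OF assms] by (simp add: tot_diff_def)

lemma D_in: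
  assumes "w \<in> Tot n"
  shows "D n w \<in> Tot (Suc n)"
  unfolding tot_space_def
proof safe
  fix p assume "p \<le> Suc n"
  show "D n w p \<in> CC p (Suc n - p)"
  proof (cases p)
    case 0
    then show ?thesis
      using v_in[OF Tot_nth[OF assms, of 0]] by (simp add: D_0)
  next
    case (Suc p')
    have "h p' (n - p') (w p') \<in> CC p (Suc n - p)"
      using h_in[OF Tot_nth[OF assms, of p']] Suc by simp
    \<comment> \<open>\<open>Suc n - p = Suc (n - p)\<close> requires \<open>p \<le> n\<close>; in
      the remaining column \<open>p = Suc n\<close> the component \<open>w p\<close> is
      padding.\<close>
    moreover have "v p (n - p) (w p) \<in> CC p (Suc n - p)"
    proof (cases "p \<le> n")
      case True
      then show ?thesis
        using v_in[OF Tot_nth[OF assms, of p]] by (simp add: Suc_diff_le)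
    next
      case False
      then show ?thesis
        by (simp add: Tot_vanish[OF assms] subspace_0[OF subspace_CC])
    qed
    ultimately show ?thesis
      using Suc D_Suc[OF assms, of p'] by (auto intro: subspace_add[OF subspace_CC])
  qed
next
  fix p assume "Suc n < p"
  then obtain p' where "p = Suc p'" "n < p'"
    by (cases p) auto
  then show "D n w p = 0"
    by (simp add: D_Suc[OF assms] Tot_vanish[OF assms])
qed

text \<open>Each column collects two horizontal steps, the mixed pair and two vertical steps; each
  group vanishes on its own. Columns 0 and 1 have fewer groups.\<close>

lemma D_D:
  assumes w: "w \<in> Tot n"
  shows "D (Suc n) (D n w) = 0"
proof
  fix p
  have w_in: "w p \<in> CC p (n - p)" for p
    by (rule Tot_nth[OF w])
  have vv: "v p (Suc n - p) (v p (n - p) (w p)) = 0" for p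
    using v_v[OF w_in, of p] by (cases "p \<le> n") (simp_all add: Suc_diff_le Tot_vanish[OF w])
  have hv: "h p (Suc n - p) (v p (n - p) (w p)) + v (Suc p) (n - p) (h p (n - p) (w p)) = 0" for p
    using h_v[OF w_in, of p] by (cases "p \<le> n") (simp_all add: Suc_diff_le Tot_vanish[OF w])
  have hh: "h (Suc p) (n - p) (h p (n - p) (w p)) = 0" for p
    by (rule h_h[OF w_in])
  show "D (Suc n) (D n w) p = 0 p"
  proof (cases p)
    case 0
    then show ?thesis
      using vv[of 0] by (simp add: D_0)
  next
    case (Suc p')
    show ?thesis
    proof (cases p')
      case 0
      then show ?thesis
        using Suc hv[of 0] vv[of 1]
        by (simp add: D_Suc[OF D_in[OF w]] D_Suc[OF w] D_0 v.add add.assoc[symmetric])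
    next
      case (Suc m)
      let ?a = "h (Suc m) (n - m) (h m (n - m) (w m))"
        and ?b = "h (Suc m) (n - m) (v (Suc m) (n - Suc m) (w (Suc m)))"
        and ?c = "v (Suc (Suc m)) (n - Suc m) (h (Suc m) (n - Suc m) (w (Suc m)))"
        and ?d = "v (Suc (Suc m)) (n - Suc m) (v (Suc (Suc m)) (n - Suc (Suc m)) (w (Suc (Suc m))))"
      have "D (Suc n) (D n w) p = ?a + ?b + (?c + ?d)"
        using \<open>p = Suc p'\<close> Suc
        by (simp add: D_Suc[OF D_in[OF w]] D_Suc[OF w] h.add v.add)
      also have "\<dots> = ?a + (?b + ?c) + ?d"
        by (simp add: add.assoc)
      finally show ?thesis
        using hh[of m] hv[of "Suc m"] vv[of "Suc (Suc m)"] by simp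
    qed
  qed
qed

lemma subspace_cocycles_Tot: "tot.subspace (cocycles Tot D n)"
  using tot.subspace_inter[OF subspace_Tot D.subspace_kernel, of n n]
  by (simp add: cocycles_def Int_def)

lemma subspace_coboundaries_Tot: "tot.subspace (coboundaries Tot D n)"
  by (cases n) (auto simp: coboundaries_def intro: D.subspace_image subspace_Tot)

lemma coboundaries_Tot_subset: "coboundaries Tot D n \<subseteq> cocycles Tot D n"
proof (cases n)
  case 0
  then show ?thesis
    unfolding coboundaries_def by (simp add: tot.subspace_0[OF subspace_cocycles_Tot])
next
  case (Suc m)
  then show ?thesis
    unfolding coboundaries_def cocycles_def by (auto simp del: zero_fun_apply intro: D_in D_D)
qed

text \<open>
  The components of \<open>w\<close> in positive columns are removed from the highest column downwards:
  if \<open>w\<close> vanishes beyond column \<open>k > 0\<close>, then \<open>w k\<close> is a cocycle of its row.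
\<close>

lemma cohomologous_to_column_0:
  assumes "w \<in> Tot n" and "\<And>p. D n w (Suc p) = 0"
  shows "\<exists>z\<in>coboundaries Tot D n. \<forall>p>0. w p = z p"
proof -
  \<comment> \<open>Induction on a bound \<open>k\<close> for the nonzero columns;
    \<open>k = n\<close> covers every total cochain.\<close>
  have "\<exists>z\<in>coboundaries Tot D n. \<forall>p>0. w p = z p"
    if "w \<in> Tot n" "\<And>p. D n w (Suc p) = 0" "\<forall>p>k. w p = 0" for k w
    using that
  proof (induction k arbitrary: w)
    case 0
    show ?case
    proof (rule bexI[OF _ tot.subspace_0[OF subspace_coboundaries_Tot]])
      show "\<forall>p>0. w p = 0 p"
        using 0(3) by simp
    qed
  next
    case (Suc k)
    note w = Suc.prems(1)
    show ?case
    proof (cases "w (Suc k) = 0")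
      case True
      then have "\<forall>p>k. w p = 0"
        using Suc.prems(3) by (metis Suc_lessI)
      then show ?thesis
        using Suc.IH Suc.prems by blast
    next
      case False
      then have k: "Suc k \<le> n"
        using Tot_vanish[OF w] not_less by blast
      then obtain m where m: "n = Suc m"
        by (cases n) auto
      have "h (Suc k) (n - Suc k) (w (Suc k)) = 0"
        using Suc.prems(2)[of "Suc k"] Suc.prems(3) by (simp add: D_Suc[OF w])
      with row_exact[OF Tot_nth[OF w]] obtain x
        where x: "x \<in> CC k (m - k)" "w (Suc k) = h k (m - k) x"
        using m by auto
      \<comment> \<open>As \<open>m - k = n - Suc k\<close>, placing \<open>x\<close> in column
        \<open>k\<close> gives a cochain of degree \<open>m\<close>. Its image under
        \<open>D\<close> is \<open>w (Suc k)\<close> in column \<open>Suc k\<close> and otherwise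
        touches only column \<open>k\<close>.\<close>
      define u where "u = (\<lambda>p. if p = k then x else 0)"
      have u: "u \<in> Tot m"
        using x k m by (auto simp: u_def tot_space_def subspace_0[OF subspace_CC])
      have Du: "D m u \<in> coboundaries Tot D n"
        using u m by (simp add: coboundaries_def)
      then have Du0: "D n (D m u) = 0" "D m u \<in> Tot n"
        using coboundaries_Tot_subset by (auto simp: cocycles_def)
      have "w - D m u \<in> Tot n"
        by (rule tot.subspace_diff[OF subspace_Tot w Du0(2)])
      moreover have "D n (w - D m u) (Suc p) = 0" for p
        using Suc.prems(2) by (simp add: D.diff Du0)
      moreover have "(w - D m u) p = 0" if "p > k" for p
      proof -
        obtain p' where p': "p = Suc p'" "p' \<ge> k"
          using \<open>p > k\<close> by (cases p) auto
        have "D m u p = h p' (m - p') (u p') + v (Suc p') (m - Suc p') (u (Suc p'))"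
          unfolding p'(1) by (rule D_Suc[OF u])
        then show ?thesis
          using x Suc.prems(3) p' by (cases "p' = k") (simp_all add: u_def[THEN fun_cong])
      qed
      ultimately obtain z
        where z: "z \<in> coboundaries Tot D n" "\<forall>p>0. (w - D m u) p = z p"
        using Suc.IH by blast
      show ?thesis
        using z tot.subspace_add[OF subspace_coboundaries_Tot z(1) Du]
        by (intro bexI[of _ "z + D m u"]) (auto simp: algebra_simps)
    qed
  qed
  moreover have "\<forall>p>n. w p = 0"
    using Tot_vanish[OF assms(1)] by blast
  ultimately show ?thesis
    using assms by blast
qed

section \<open>The edge map from the row kernels in column 0 to the total complex\<close>

abbreviation edge :: "nat \<Rightarrow> 'v set" where
  "edge q \<equiv> {x \<in> CC 0 q. h 0 q x = 0}"

definition edge_embed :: "'v \<Rightarrow> nat \<Rightarrow> 'v" where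
  "edge_embed x = (\<lambda>p. if p = 0 then x else 0)"

lemma edge_embed_in: "x \<in> CC 0 n \<Longrightarrow> edge_embed x \<in> Tot n"
  by (auto simp: edge_embed_def tot_space_def subspace_0[OF subspace_CC])

lemma D_edge_embed:
  assumes "x \<in> edge n"
  shows "D n (edge_embed x) = edge_embed (v 0 n x)"
proof
  fix p
  show "D n (edge_embed x) p = edge_embed (v 0 n x) p"
    using assms edge_embed_in[of x n]
    by (cases p) (auto simp: D_0 D_Suc edge_embed_def)
qed

text \<open>Once the positive columns of \<open>w\<close> vanish, column 1 of \<open>D n w\<close>
  is just \<open>h 0 n (w 0)\<close>.\<close>

lemma column_0_cocycle:
  assumes w: "w \<in> Tot n" and "\<And>p. D n w (Suc p) = 0" and "\<forall>p>0. w p = 0"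
  shows "w 0 \<in> edge n" "w = edge_embed (w 0)"
  using Tot_nth[OF w, of 0] assms(2)[of 0] assms(3)
  by (auto simp: D_Suc[OF w] edge_embed_def)

text \<open>Surjectivity: a total cocycle moves into column 0 by a coboundary. Injectivity: a total
  primitive of a column 0 element is moved there in the same way.\<close>

theorem edge_cohomology:
  "vspace_isomorphic (cohomology scale edge (v 0) n) (cohomology tot_scale Tot D n)"
proof -
  interpret embed: module_hom scale tot_scale edge_embed
    by unfold_locales (auto simp: edge_embed_def)
  have edge: "subspace (edge m)" for m
    using subspace_inter[OF subspace_CC h.subspace_kernel] by (simp add: Int_def)
  have embed_inj: "edge_embed x = edge_embed y \<longleftrightarrow> x = y" for x y
    by (auto simp: edge_embed_def fun_eq_iff)
  have cocycle_iff: "x \<in> cocycles edge (v 0) n \<longleftrightarrow> x \<in> edge n \<and> edge_embed x \<in> cocycles Tot D n" for x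
    using D_edge_embed[of x n] embed_inj[of "v 0 n x" 0] embed.zero edge_embed_in[of x n]
    by (auto simp: cocycles_def)
  show ?thesis
    unfolding cohomology_def
  proof (rule embed.vspace_isomorphic_quotient)
    show "subspace (coboundaries edge (v 0) n)"
      by (cases n) (auto simp: coboundaries_def intro: v.subspace_image edge)
    show "coboundaries edge (v 0) n \<subseteq> cocycles edge (v 0) n"
    proof (cases n)
      case 0
      then show ?thesis
        by (simp add: coboundaries_def cocycles_def subspace_0[OF subspace_CC])
    next
      case (Suc m)
      \<comment> \<open>Anticommutation carries the row kernel in degree \<open>m\<close> into the
        one in degree \<open>n\<close>.\<close>
      have "h 0 n (v 0 m x) = 0" if "x \<in> edge m" for x
        using that h_v[of x 0 m] Suc by simp
      then show ?thesis
        using Suc by (auto simp: coboundaries_def cocycles_def v_in v_v)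
    qed
    show "subspace (cocycles edge (v 0) n)"
      using subspace_inter[OF edge v.subspace_kernel, of n 0 n]
      by (simp add: cocycles_def Int_def)
    show "tot.subspace (coboundaries Tot D n)"
      by (rule subspace_coboundaries_Tot)
  next
    fix x assume "x \<in> cocycles edge (v 0) n"
    then show "edge_embed x \<in> cocycles Tot D n"
      by (simp add: cocycle_iff)
    show "edge_embed x \<in> coboundaries Tot D n \<longleftrightarrow> x \<in> coboundaries edge (v 0) n"
    proof (cases n)
      case 0
      then show ?thesis
        using embed_inj[of x 0] embed.zero by (simp add: coboundaries_def)
    next
      case (Suc m)
      show ?thesis
      proof
        assume "x \<in> coboundaries edge (v 0) n"
        then obtain y where "y \<in> edge m" "x = v 0 m y"
          using Suc by (auto simp: coboundaries_def)
        then show "edge_embed x \<in> coboundaries Tot D n"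
          using Suc edge_embed_in[of y m] D_edge_embed[of y m]
          by (auto simp: coboundaries_def intro!: image_eqI[of _ _ "edge_embed y"])
      next
        assume "edge_embed x \<in> coboundaries Tot D n"
        then obtain u where u: "u \<in> Tot m" "D m u = edge_embed x"
          using Suc by (auto simp: coboundaries_def)
        \<comment> \<open>The primitive \<open>u\<close> need not be a cocycle: only the positive
          columns of \<open>D m u\<close> vanish, which is all the reduction to column 0 asks
          for.\<close>
        then have "D m u (Suc p) = 0" for p
          by (simp add: edge_embed_def)
        then obtain z where z: "z \<in> coboundaries Tot D m" "\<forall>p>0. u p = z p"
          using cohomologous_to_column_0[OF u(1)] by auto
        then have z': "z \<in> Tot m" "D m z = 0"
          using coboundaries_Tot_subset by (auto simp: cocycles_def)
        have Duz: "D m (u - z) = edge_embed x"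
          by (simp add: D.diff z' u)
        let ?y = "(u - z) 0"
        have uz: "u - z \<in> Tot m"
          by (rule tot.subspace_diff[OF subspace_Tot u(1) z'(1)])
        have "D m (u - z) (Suc p) = 0" for p
          unfolding Duz by (simp add: edge_embed_def)
        moreover have "\<forall>p>0. (u - z) p = 0"
          using z by simp
        ultimately have "?y \<in> edge m" "u - z = edge_embed ?y"
          by (rule column_0_cocycle[OF uz])+
        then have "edge_embed x = edge_embed (v 0 m ?y)"
          using Duz D_edge_embed[of ?y m] by metis
        then show "x \<in> coboundaries edge (v 0) n"
          using \<open>?y \<in> edge m\<close> Suc unfolding embed_inj by (auto simp: coboundaries_def)
      qed
    qed
  next
    fix w assume w: "w \<in> cocycles Tot D n"
    then obtain z where z: "z \<in> coboundaries Tot D n" "\<forall>p>0. w p = z p"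
      using cohomologous_to_column_0[of w n] by (auto simp: cocycles_def)
    have wz: "w - z \<in> cocycles Tot D n"
      using z coboundaries_Tot_subset w by (blast intro: tot.subspace_diff[OF subspace_cocycles_Tot])
    let ?x = "(w - z) 0"
    have "\<forall>p>0. (w - z) p = 0"
      using z by simp
    moreover have "w - z \<in> Tot n" "D n (w - z) (Suc p) = 0" for p
      using wz by (simp_all add: cocycles_def del: minus_apply)
    ultimately have x: "?x \<in> edge n" "w - z = edge_embed ?x"
      using column_0_cocycle[of "w - z" n] by blast+
    have "?x \<in> cocycles edge (v 0) n"
      unfolding cocycle_iff using x(1) wz unfolding x(2)[symmetric] by blast
    moreover have "w - edge_embed ?x \<in> coboundaries Tot D n"
      using z(1) unfolding x(2)[symmetric] by simp
    ultimately show "\<exists>x\<in>cocycles edge (v 0) n. w - edge_embed x \<in> coboundaries Tot D n"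
      by blast
  qed
qed

end


section \<open>The cyclic operator\<close>

lemma sum_fun_apply: "(\<Sum>i\<in>A. f i) x = (\<Sum>i\<in>A. f i x)" for f :: "_ \<Rightarrow> _ \<Rightarrow> _::comm_monoid_add"
  by (induction A rule: infinite_finite_induct) auto

lemma scale_cochain_eq: "scale_cochain = (\<lambda>c \<phi> as. c * \<phi> as)"
  by (simp add: scale_cochain_def fun_eq_iff)

lemma module_scale_cochain: "module (scale_cochain :: 'k::field \<Rightarrow> ('a list \<Rightarrow> 'k) \<Rightarrow> _)"
  unfolding scale_cochain_eq by unfold_locales (auto simp: algebra_simps)

global_interpretation cochain: module "scale_cochain :: 'k::field \<Rightarrow> ('a list \<Rightarrow> 'k) \<Rightarrow> _"
  by (rule module_scale_cochain)

lemma module_hom_cyc_t: "module_hom scale_cochain scale_cochain (cyc_t n)"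
  by unfold_locales (auto simp: cyc_t_def scale_cochain_def algebra_simps fun_eq_iff)

global_interpretation cyc_t: module_hom scale_cochain scale_cochain "cyc_t n" for n
  by (rule module_hom_cyc_t)

lemma module_hom_cyc_t_power: "module_hom scale_cochain scale_cochain (cyc_t n ^^ j)"
proof (induction j)
  case 0
  show ?case
    by (simp only: funpow.simps cochain.module_hom_id)
next
  case (Suc j)
  then show ?case
    by (simp only: funpow.simps module_hom_compose[OF _ module_hom_cyc_t])
qed

lemma module_hom_cyc_N: "module_hom scale_cochain scale_cochain (cyc_N n)"
  unfolding cyc_N_def[abs_def]
  by (rule module_pair.module_hom_sum)
    (auto intro: module_hom_cyc_t_power module_pair.intro cochain.module_axioms)

text \<open>The inverse of \<open>rotate1\<close> on nonempty lists; \<open>cyc_t\<close> is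
  pullback along it up to sign.\<close>

definition rot :: "'a list \<Rightarrow> 'a list" where
  "rot as = last as # butlast as"

lemma length_rot: "as \<noteq> [] \<Longrightarrow> length (rot as) = length as"
  by (simp add: rot_def)

lemma rotate1_rot: "as \<noteq> [] \<Longrightarrow> rotate1 (rot as) = as"
  by (simp add: rot_def)

lemma length_rot_power: "as \<noteq> [] \<Longrightarrow> length ((rot ^^ j) as) = length as"
proof (induction j)
  case (Suc j)
  then have "(rot ^^ j) as \<noteq> []"
    by (metis length_0_conv)
  then show ?case
    using Suc by (simp add: length_rot)
qed simp

lemma rotate_rot_power: "as \<noteq> [] \<Longrightarrow> rotate j ((rot ^^ j) as) = as"
proof (induction j)
  case (Suc j)
  have "(rot ^^ j) as \<noteq> []"
    using Suc.prems length_rot_power[of as j] by auto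
  then show ?case
    using Suc by (simp add: rotate1_rotate_swap rotate1_rot)
qed simp

text \<open>\<open>rotate (length as)\<close> is the identity and also undoes this power of
  \<open>rot\<close>; for the empty list the exponent is 0.\<close>

lemma rot_power_length: "(rot ^^ length as) as = as"
proof (cases "as = []")
  case False
  then show ?thesis
    using rotate_rot_power[of as "length as"] length_rot_power[of as "length as"] by simp
qed simp

lemma cyc_t_eq: "cyc_t n \<phi> = (\<lambda>as. if length as = n + 1 then (-1) ^ n * \<phi> (rot as) else 0)"
  unfolding cyc_t_def rot_def ..

lemma cyc_t_power:
  "length as = n + 1 \<Longrightarrow> (cyc_t n ^^ j) \<phi> as = (-1) ^ (n * j) * \<phi> ((rot ^^ j) as)"
proof (induction j arbitrary: as)
  case (Suc j)
  have "length (rot as) = n + 1"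
    using Suc.prems by (subst length_rot) auto
  then show ?case
    using Suc by (simp add: cyc_t_eq power_add funpow_swap1)
qed simp

lemma cochains_vanish: "\<phi> \<in> cochains scale n \<Longrightarrow> length as \<noteq> n + 1 \<Longrightarrow> \<phi> as = 0"
  by (simp add: cochains_def)

text \<open>The accumulated sign is trivial because \<open>n * Suc n\<close> is even. On lists of
  wrong length \<open>cyc_t\<close> returns 0, which agrees with a cochain.\<close>

lemma cyc_t_power_Suc:
  fixes scale :: "'k::field \<Rightarrow> 'a::ab_group_add \<Rightarrow> 'a"
  assumes "\<phi> \<in> cochains scale n"
  shows "(cyc_t n ^^ Suc n) \<phi> = \<phi>"
proof
  fix as :: "'a list"
  show "(cyc_t n ^^ Suc n) \<phi> as = \<phi> as"
  proof (cases "length as = Suc n")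
    case True
    have "even (n * Suc n)"
      by simp
    then have "(-1 :: 'k) ^ (n * Suc n) = 1"
      unfolding minus_one_power_iff by simp
    then show ?thesis
      using True rot_power_length[of as] cyc_t_power[of as n "Suc n" \<phi>] by simp
  next
    case False
    then show ?thesis
      using cochains_vanish[OF assms, of as] by (simp add: cyc_t_def)
  qed
qed

lemma rot_update:
  assumes "length as = Suc n" "i \<le> n"
  shows "rot (as[i := x]) = (rot as)[(if i = n then 0 else Suc i) := x]"
  using assms by (auto simp: rot_def last_conv_nth butlast_list_update nth_list_update simp flip: length_0_conv)

lemma vector_space_field: "vector_space ((*) :: 'k::field \<Rightarrow> 'k \<Rightarrow> 'k)"
  by unfold_locales (auto simp: algebra_simps)

lemma subspace_cochains:
  fixes scale :: "'k::field \<Rightarrow> 'a::ab_group_add \<Rightarrow> 'a"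
  assumes "vector_space scale"
  shows "cochain.subspace (cochains scale n)"
  using assms unfolding cochain.subspace_def cochains_def
  by (auto simp: Vector_Spaces.linear_iff vector_space_field scale_cochain_def algebra_simps)

lemma cyc_t_in_cochains:
  assumes "\<phi> \<in> cochains scale n"
  shows "cyc_t n \<phi> \<in> cochains scale n"
proof -
  have "Vector_Spaces.linear scale (*) (\<lambda>x. cyc_t n \<phi> (as[i := x]))"
    if as: "length as = n + 1" and i: "i \<le> n" for as i
  proof -
    have "length (rot as) = n + 1"
      using as by (subst length_rot) auto
    then have "Vector_Spaces.linear scale (*) (\<lambda>x. \<phi> ((rot as)[(if i = n then 0 else Suc i) := x]))"
      using assms i by (auto simp: cochains_def)
    then show ?thesis
      using as i by (simp add: cyc_t_eq rot_update[of _ n] Vector_Spaces.linear_iff algebra_simps)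
  qed
  then show ?thesis
    by (simp add: cochains_def) (simp add: cyc_t_def)
qed

lemma cyc_t_power_in_cochains:
  "\<phi> \<in> cochains scale n \<Longrightarrow> (cyc_t n ^^ j) \<phi> \<in> cochains scale n"
  by (induction j) (auto simp: cyc_t_in_cochains)

lemma cyc_N_in_cochains:
  "vector_space scale \<Longrightarrow> \<phi> \<in> cochains scale n \<Longrightarrow> cyc_N n \<phi> \<in> cochains scale n"
  unfolding cyc_N_def
  by (intro cochain.subspace_sum subspace_cochains cyc_t_power_in_cochains)

section \<open>Relations between \<open>cyc_t\<close> and \<open>cyc_N\<close>, and exactness of the
  rows\<close>

lemma cyc_N_cyc_t:
  assumes "\<phi> \<in> cochains scale n"
  shows "cyc_N n (cyc_t n \<phi>) = cyc_N n \<phi>"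
proof -
  have "cyc_N n (cyc_t n \<phi>) = (\<Sum>j\<le>n. (cyc_t n ^^ Suc j) \<phi>)"
    by (simp add: cyc_N_def funpow_swap1)
  \<comment> \<open>The top power \<open>Suc n\<close> wraps around to the missing power 0.\<close>
  also have "\<dots> = cyc_N n \<phi>"
    using sum.atMost_Suc_shift[of "\<lambda>j. (cyc_t n ^^ j) \<phi>" n] cyc_t_power_Suc[OF assms]
    by (simp add: cyc_N_def)
  finally show ?thesis .
qed

lemma cyc_t_cyc_N:
  assumes "\<phi> \<in> cochains scale n"
  shows "cyc_t n (cyc_N n \<phi>) = cyc_N n \<phi>"
  using cyc_N_cyc_t[OF assms] by (simp add: cyc_N_def cyc_t.sum funpow_swap1)

text \<open>On a fixed cochain \<open>cyc_N\<close> is multiplication by \<open>n + 1\<close>,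
  invertible in characteristic 0.\<close>

lemma cyc_t_fixed_imp_range_cyc_N:
  fixes scale :: "'k::field_char_0 \<Rightarrow> 'a::ab_group_add \<Rightarrow> 'a"
  assumes "vector_space scale" "\<phi> \<in> cochains scale n" "cyc_t n \<phi> = \<phi>"
  shows "\<exists>\<psi>\<in>cochains scale n. \<phi> = cyc_N n \<psi>"
proof
  let ?\<psi> = "scale_cochain (1 / of_nat (Suc n)) \<phi>"
  show "?\<psi> \<in> cochains scale n"
    using assms by (intro cochain.subspace_scale subspace_cochains)
  have "(cyc_t n ^^ j) \<phi> = \<phi>" for j
    using assms(3) by (induction j) auto
  \<comment> \<open>Here \<open>of_nat (Suc n)\<close> is a constant function and the product is
    pointwise.\<close>
  then have "cyc_N n \<phi> = of_nat (Suc n) * \<phi>"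
    by (simp add: cyc_N_def)
  then have "cyc_N n ?\<psi> = scale_cochain (1 / of_nat (Suc n)) (of_nat (Suc n) * \<phi>)"
    by (simp add: module_hom.scale[OF module_hom_cyc_N])
  also have "\<dots> = \<phi>"
    by (auto simp: scale_cochain_def fun_eq_iff of_nat_fun simp del: of_nat_Suc)
  finally show "\<phi> = cyc_N n ?\<psi>"
    by simp
qed

lemma cyc_N_zero_imp_range_cyc_t:
  fixes scale :: "'k::field_char_0 \<Rightarrow> 'a::ab_group_add \<Rightarrow> 'a"
  assumes "vector_space scale" "\<phi> \<in> cochains scale n" "cyc_N n \<phi> = 0"
  shows "\<exists>\<psi>\<in>cochains scale n. \<phi> = \<psi> - cyc_t n \<psi>"
proof
  \<comment> \<open>The witness comes from \<open>(Id - t) (\<Sum>j\<le>n. j t^j) = N - (n + 1) Id\<close>.\<close>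
  define S where "S = (\<Sum>j\<le>n. scale_cochain (of_nat j) ((cyc_t n ^^ j) \<phi>))"
  define c where "c = - (1 / of_nat (Suc n) :: 'k)"
  show "scale_cochain c S \<in> cochains scale n"
    using assms(1,2) unfolding S_def
    by (intro cochain.subspace_scale cochain.subspace_sum subspace_cochains cyc_t_power_in_cochains)
  let ?g = "\<lambda>j. scale_cochain (of_nat j) ((cyc_t n ^^ j) \<phi>)"
  have "cyc_t n S = (\<Sum>j\<le>n. scale_cochain (of_nat j) ((cyc_t n ^^ Suc j) \<phi>))"
    by (simp add: S_def cyc_t.sum cyc_t.scale)
  \<comment> \<open>Writing j as (j + 1) - 1 makes coefficient and exponent match again.\<close>
  also have "\<dots> = (\<Sum>j\<le>n. ?g (Suc j) - (cyc_t n ^^ Suc j) \<phi>)"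
    by (intro sum.cong) (auto simp: cochain.scale_left_distrib)
  also have "\<dots> = (\<Sum>j\<le>n. ?g (Suc j)) - cyc_N n (cyc_t n \<phi>)"
    by (simp add: sum_subtractf cyc_N_def funpow_swap1)
  \<comment> \<open>The summand for j = 0 has coefficient 0, so the shift only adds the top
    term.\<close>
  also have "(\<Sum>j\<le>n. ?g (Suc j)) = S + ?g (Suc n)"
    using sum.atMost_Suc_shift[of ?g n] by (simp add: S_def)
  also have "cyc_N n (cyc_t n \<phi>) = 0"
    using cyc_N_cyc_t[OF assms(2)] assms(3) by simp
  also have "?g (Suc n) = scale_cochain (of_nat (Suc n)) \<phi>"
    by (simp only: cyc_t_power_Suc[OF assms(2)])
  finally have "S - cyc_t n S = - scale_cochain (of_nat (Suc n)) \<phi>"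
    by (simp del: plus_fun_apply minus_apply uminus_apply zero_fun_apply)
  then have "scale_cochain c (S - cyc_t n S) = scale_cochain c (- scale_cochain (of_nat (Suc n)) \<phi>)"
    by simp
  moreover have "scale_cochain c (- scale_cochain (of_nat (Suc n)) \<phi>) = \<phi>"
    by (simp add: c_def scale_cochain_def fun_eq_iff del: of_nat_Suc)
  ultimately show "\<phi> = scale_cochain c S - cyc_t n (scale_cochain c S)"
    by (simp add: cyc_t.scale cochain.scale_right_diff_distrib)
qed

section \<open>Faces\<close>

context hom_associative_algebra
begin

text \<open>The Hochschild face maps twisted by \<open>\<alpha>\<close>. Every index from
  \<open>length as - 1\<close> on gives the cyclic face, which multiplies the last entry into the
  first.\<close>

definition face :: "nat \<Rightarrow> 'a list \<Rightarrow> 'a list" where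
  "face i as =
     (if Suc i < length as
      then map \<alpha> (take i as) @ mu (as ! i) (as ! Suc i) # map \<alpha> (drop (i + 2) as)
      else mu (last as) (hd as) # map \<alpha> (tl (butlast as)))"

lemma length_face: "2 \<le> length as \<Longrightarrow> length (face i as) = length as - 1"
  by (auto simp: face_def)

lemma face_nth:
  assumes "k < length as - 1" "i < length as"
  shows "face i as ! k =
    (if Suc i < length as
     then if k < i then \<alpha> (as ! k) else if k = i then mu (as ! i) (as ! Suc i) else \<alpha> (as ! Suc k)
     else if k = 0 then mu (as ! (length as - 1)) (as ! 0) else \<alpha> (as ! k))"
proof (cases "Suc i < length as")
  case True
  consider "k < i" | "k = i" | d where "k = Suc (i + d)"
    using less_imp_Suc_add[of i k] by (metis linorder_neqE_nat)
  then show ?thesis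
    using True assms by cases (simp_all add: face_def nth_append)
next
  case False
  then have "last as = as ! (length as - 1)" "hd as = as ! 0" "i = length as - 1"
    using assms by (auto simp: last_conv_nth hd_conv_nth simp flip: length_0_conv)
  then show ?thesis
    using False assms by (auto simp: face_def nth_Cons nth_tl nth_butlast split: nat.split)
qed

lemma inner_face_nth:
  assumes "Suc i < length as"
  shows "k < i \<Longrightarrow> face i as ! k = \<alpha> (as ! k)"
    and "face i as ! i = mu (as ! i) (as ! Suc i)"
    and "i < k \<Longrightarrow> Suc k < length as \<Longrightarrow> face i as ! k = \<alpha> (as ! Suc k)"
  using assms by (simp_all add: face_nth)

lemma last_face_nth:
  assumes "length as = Suc i" "0 < i"
  shows "face i as ! 0 = mu (as ! i) (as ! 0)"
    and "0 < k \<Longrightarrow> k < i \<Longrightarrow> face i as ! k = \<alpha> (as ! k)"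
  using assms by (simp_all add: face_nth)

lemma face_rot:
  assumes "length as = n + 2" "i \<le> n"
  shows "face (Suc i) (rot as) = rot (face i as)"
proof (rule nth_equalityI)
  have ne: "as \<noteq> []" "face i as \<noteq> []"
    using assms length_face[of as i] by auto
  show len: "length (face (Suc i) (rot as)) = length (rot (face i as))"
    using assms ne by (simp add: length_face length_rot)
  fix k assume "k < length (face (Suc i) (rot as))"
  then have k: "k < n + 1"
    using assms ne by (simp add: length_face length_rot)
  have r: "rot as ! l = (if l = 0 then as ! (n + 1) else as ! (l - 1))" if "l < n + 2" for l
    using that assms ne by (cases l) (auto simp: rot_def last_conv_nth nth_butlast)
  have "rot (face i as) ! k = (if k = 0 then face i as ! n else face i as ! (k - 1))"
    using k assms ne by (cases k) (auto simp: rot_def last_conv_nth nth_butlast length_face)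
  then show "face (Suc i) (rot as) ! k = rot (face i as) ! k"
    using k assms ne by (auto simp: face_nth length_rot r)
qed

lemma face_0_rot:
  assumes "length as = n + 2"
  shows "face 0 (rot as) = face (Suc n) as"
proof -
  have "as \<noteq> []" "butlast as \<noteq> []"
    using assms by (auto simp flip: length_0_conv)
  then have "hd (butlast as) = hd as"
    by (cases as) auto
  with \<open>butlast as \<noteq> []\<close> show ?thesis
    using assms by (simp add: face_def rot_def nth_Cons drop_Suc hd_conv_nth)
qed

text \<open>Serves the multilinearity of cofaces: an entry enters exactly one entry of an inner
  face, through \<open>\<alpha>\<close> or through multiplication by its fixed neighbour.\<close>

lemma face_update:
  assumes as: "length as = n + 2" and i: "i \<le> n" and j: "j \<le> n + 1"
  shows "\<exists>j' f. j' \<le> n \<and> Vector_Spaces.linear scale scale f \<and>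
    (\<forall>x. face i (as[j := x]) = (face i as)[j' := f x])"
proof -
  consider "j < i" | "j = i" | "j = Suc i" | "Suc i < j"
    by linarith
  then show ?thesis
  proof cases
    case 1
    then show ?thesis
      using as i linear_alpha
      by (intro exI[of _ j] exI[of _ \<alpha>])
        (auto intro!: nth_equalityI simp: length_face face_nth nth_list_update)
  next
    case 2
    then show ?thesis
      using as i linear_mu_left
      by (intro exI[of _ i] exI[of _ "\<lambda>x. mu x (as ! Suc i)"])
        (auto intro!: nth_equalityI simp: length_face face_nth nth_list_update)
  next
    case 3
    then show ?thesis
      using as i linear_mu_right
      by (intro exI[of _ i] exI[of _ "\<lambda>x. mu (as ! i) x"])
        (auto intro!: nth_equalityI simp: length_face face_nth nth_list_update)
  next
    case 4
    then show ?thesis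
      using as i j linear_alpha
      by (intro exI[of _ "j - 1"] exI[of _ \<alpha>])
        (auto intro!: nth_equalityI simp: length_face face_nth nth_list_update)
  qed
qed

text \<open>With the sign built in, both differentials are plain sums of cofaces and
  \<open>cyc_t\<close> permutes cofaces without further signs.\<close>

definition coface :: "nat \<Rightarrow> nat \<Rightarrow> ('a list \<Rightarrow> 'k) \<Rightarrow> 'a list \<Rightarrow> 'k" where
  "coface n i \<phi> = (\<lambda>as. if length as = n + 2 then (-1) ^ i * \<phi> (face i as) else 0)"

lemma module_hom_coface: "module_hom scale_cochain scale_cochain (coface n i)"
  by unfold_locales (auto simp: coface_def scale_cochain_def algebra_simps fun_eq_iff)

text \<open>By \<open>face_rot\<close>; raising both n and i by one leaves the product of signs
  unchanged.\<close>

lemma cyc_t_coface_Suc: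
  assumes "i \<le> n"
  shows "cyc_t (Suc n) (coface n (Suc i) \<phi>) = coface n i (cyc_t n \<phi>)"
proof
  fix as :: "'a list"
  show "cyc_t (Suc n) (coface n (Suc i) \<phi>) as = coface n i (cyc_t n \<phi>) as"
  proof (cases "length as = n + 2")
    case True
    then have "length (rot as) = n + 2"
      by (subst length_rot) auto
    then show ?thesis
      using True assms by (simp add: cyc_t_eq coface_def face_rot length_face)
  qed (simp add: cyc_t_eq coface_def)
qed

text \<open>The sign of \<open>cyc_t (Suc n)\<close> is exactly the one of the last coface.\<close>

lemma cyc_t_coface_0: "cyc_t (Suc n) (coface n 0 \<phi>) = coface n (Suc n) \<phi>"
proof
  fix as :: "'a list"
  show "cyc_t (Suc n) (coface n 0 \<phi>) as = coface n (Suc n) \<phi> as"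
  proof (cases "length as = n + 2")
    case True
    then have "length (rot as) = n + 2"
      by (subst length_rot) auto
    then show ?thesis
      using True by (simp add: cyc_t_eq coface_def face_0_rot)
  qed (simp add: cyc_t_eq coface_def)
qed

lemma coface_in_cochains:
  assumes \<phi>: "\<phi> \<in> cochains scale n" and "i \<le> Suc n"
  shows "coface n i \<phi> \<in> cochains scale (Suc n)"
proof -
  have inner: "coface n i \<phi> \<in> cochains scale (Suc n)" if i: "i \<le> n" for i
  proof -
    have "Vector_Spaces.linear scale (*) (\<lambda>x. coface n i \<phi> (as[j := x]))"
      if as: "length as = Suc n + 1" and j: "j \<le> Suc n" for as j
    proof -
      obtain j' f where f: "j' \<le> n" "Vector_Spaces.linear scale scale f"
        "\<And>x. face i (as[j := x]) = (face i as)[j' := f x]"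
        using face_update[of as n i j] as i j by auto
      have "Vector_Spaces.linear scale (*) (\<lambda>x. \<phi> ((face i as)[j' := x]))"
        using \<phi> as f(1) length_face[of as i] by (simp add: cochains_def)
      then show ?thesis
        using as f(2) by (simp add: coface_def f(3) Vector_Spaces.linear_iff algebra_simps)
    qed
    then show ?thesis
      by (simp add: cochains_def) (simp add: coface_def)
  qed
  \<comment> \<open>The cyclic coface is \<open>cyc_t\<close> of coface 0 and inherits
    multilinearity from it.\<close>
  then show ?thesis
    using \<open>i \<le> Suc n\<close> cyc_t_in_cochains[OF inner[of 0]]
    by (cases "i = Suc n") (auto simp: cyc_t_coface_0)
qed

section \<open>The differentials as sums of cofaces, and their commutation with the row maps\<close>

lemma hom_b'_eq:
  fixes \<phi> :: "'a list \<Rightarrow> 'k"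
  shows "hom_b' mu \<alpha> n \<phi> = (\<Sum>i\<le>n. coface n i \<phi>)"
proof
  fix as :: "'a list"
  show "hom_b' mu \<alpha> n \<phi> as = (\<Sum>i\<le>n. coface n i \<phi>) as"
    by (auto simp: hom_b'_def coface_def face_def sum_fun_apply intro!: sum.cong)
qed

lemma hom_b_eq:
  fixes \<phi> :: "'a list \<Rightarrow> 'k"
  shows "hom_b mu \<alpha> n \<phi> = (\<Sum>i\<le>Suc n. coface n i \<phi>)"
proof
  fix as :: "'a list"
  have "face (Suc n) as = mu (as ! (n + 1)) (as ! 0) # map \<alpha> (take n (drop 1 as))"
    if "length as = n + 2"
  proof -
    have "as \<noteq> []"
      using that by auto
    moreover have "tl (butlast as) = take n (drop 1 as)"
      using that by (simp add: butlast_conv_take tl_take drop_Suc)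
    ultimately show ?thesis
      using that by (simp add: face_def last_conv_nth hd_conv_nth)
  qed
  then show "hom_b mu \<alpha> n \<phi> as = (\<Sum>i\<le>Suc n. coface n i \<phi>) as"
    by (auto simp: hom_b_def hom_b'_eq coface_def sum_fun_apply)
qed

lemma hom_b'_in_cochains: "\<phi> \<in> cochains scale n \<Longrightarrow> hom_b' mu \<alpha> n \<phi> \<in> cochains scale (Suc n)"
  unfolding hom_b'_eq
  by (intro cochain.subspace_sum subspace_cochains coface_in_cochains vector_space_axioms) auto

lemma hom_b_in_cochains: "\<phi> \<in> cochains scale n \<Longrightarrow> hom_b mu \<alpha> n \<phi> \<in> cochains scale (Suc n)"
  unfolding hom_b_eq
  by (intro cochain.subspace_sum subspace_cochains coface_in_cochains vector_space_axioms) auto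

lemma module_hom_hom_b': "module_hom scale_cochain scale_cochain (hom_b' mu \<alpha> n :: ('a list \<Rightarrow> 'k) \<Rightarrow> _)"
  unfolding hom_b'_eq[abs_def]
  by (intro module_pair.module_hom_sum)
    (auto intro: module_hom_coface module_pair.intro cochain.module_axioms)

lemma module_hom_hom_b: "module_hom scale_cochain scale_cochain (hom_b mu \<alpha> n :: ('a list \<Rightarrow> 'k) \<Rightarrow> _)"
  unfolding hom_b_eq[abs_def]
  by (intro module_pair.module_hom_sum)
    (auto intro: module_hom_coface module_pair.intro cochain.module_axioms simp del: sum.atMost_Suc)

text \<open>\<open>cyc_t\<close> turns coface 0 into the last coface and lowers every other index,
  so t b is the last coface plus b' t; the last coface is also b - b'.\<close>

lemma hom_b_cyc_t:
  fixes \<phi> :: "'a list \<Rightarrow> 'k"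
  shows "hom_b mu \<alpha> n \<phi> - cyc_t (Suc n) (hom_b mu \<alpha> n \<phi>) = hom_b' mu \<alpha> n (\<phi> - cyc_t n \<phi>)"
proof -
  have "cyc_t (Suc n) (hom_b mu \<alpha> n \<phi>) = cyc_t (Suc n) (coface n 0 \<phi>) + (\<Sum>i\<le>n. cyc_t (Suc n) (coface n (Suc i) \<phi>))"
    unfolding hom_b_eq sum.atMost_Suc_shift by (simp add: cyc_t.add cyc_t.sum)
  also have "(\<Sum>i\<le>n. cyc_t (Suc n) (coface n (Suc i) \<phi>)) = hom_b' mu \<alpha> n (cyc_t n \<phi>)"
    by (simp add: cyc_t_coface_Suc hom_b'_eq)
  finally show ?thesis
    by (simp add: cyc_t_coface_0 module_hom.diff[OF module_hom_hom_b'] del: plus_fun_apply minus_apply)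
      (simp add: hom_b_eq hom_b'_eq del: plus_fun_apply minus_apply)
qed

text \<open>Each \<open>cyc_t\<close> lowers the index and passes to \<open>\<phi>\<close>, except
  the step from index 0 to \<open>Suc n\<close>, which is absorbed; hence the exponent
  \<open>j - 1\<close>. The bound on \<open>j\<close> excludes a second wrap.\<close>

lemma cyc_t_power_coface:
  assumes "i \<le> n" "j \<le> Suc n"
  shows "(cyc_t (Suc n) ^^ j) (coface n i \<phi>) =
    (if j \<le> i then coface n (i - j) ((cyc_t n ^^ j) \<phi>)
     else coface n (n + 2 + i - j) ((cyc_t n ^^ (j - 1)) \<phi>))"
  using assms(2)
proof (induction j)
  case (Suc j)
  then have IH: "(cyc_t (Suc n) ^^ j) (coface n i \<phi>) =
    (if j \<le> i then coface n (i - j) ((cyc_t n ^^ j) \<phi>)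
     else coface n (n + 2 + i - j) ((cyc_t n ^^ (j - 1)) \<phi>))"
    by simp
  consider "j < i" | "j = i" | "i < j"
    by linarith
  then show ?case
  proof cases
    case 1
    then have "i - j = Suc (i - Suc j)"
      by simp
    then show ?thesis
      using 1 IH assms(1) by (simp add: cyc_t_coface_Suc)
  next
    case 2
    then show ?thesis
      using IH by (simp add: cyc_t_coface_0)
  next
    case 3
    then have "n + 2 + i - j = Suc (n + 2 + i - Suc j)" "n + 2 + i - Suc j \<le> n"
      using Suc.prems by auto
    moreover obtain j' where "j = Suc j'"
      using 3 by (cases j) auto
    ultimately show ?thesis
      using 3 IH by (simp add: cyc_t_coface_Suc)
  qed
qed simp

text \<open>Moving the powers of \<open>cyc_t\<close> inside makes every pair of a coface and a
  power occur exactly once.\<close>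

lemma hom_b_cyc_N:
  fixes \<phi> :: "'a list \<Rightarrow> 'k"
  shows "hom_b mu \<alpha> n (cyc_N n \<phi>) = cyc_N (Suc n) (hom_b' mu \<alpha> n \<phi>)"
proof -
  let ?T = "\<lambda>(j, i). (cyc_t (Suc n) ^^ j) (coface n i \<phi>)"
    and ?S = "\<lambda>(m, l). coface n m ((cyc_t n ^^ l) \<phi>)"
  have "cyc_N (Suc n) (hom_b' mu \<alpha> n \<phi>) = (\<Sum>j\<le>Suc n. \<Sum>i\<le>n. ?T (j, i))"
    by (simp add: cyc_N_def hom_b'_eq module_hom.sum[OF module_hom_cyc_t_power] del: sum.atMost_Suc)
  also have "\<dots> = sum ?T ({..Suc n} \<times> {..n})"
    by (simp add: sum.cartesian_product)
  \<comment> \<open>The value of m + l inverts the map: it is i without a wrap and n + 1 + i after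
    one.\<close>
  also have "\<dots> = sum ?S ({..Suc n} \<times> {..n})"
    by (rule sum.reindex_bij_witness[where
          j = "\<lambda>(j, i). if j \<le> i then (i - j, j) else (n + 2 + i - j, j - 1)" and
          i = "\<lambda>(m, l). if m + l \<le> n then (l, m + l) else (l + 1, m + l - (n + 1))"])
      (auto simp: cyc_t_power_coface split: if_splits)
  also have "\<dots> = (\<Sum>m\<le>Suc n. \<Sum>l\<le>n. ?S (m, l))"
    by (simp add: sum.cartesian_product)
  also have "\<dots> = hom_b mu \<alpha> n (cyc_N n \<phi>)"
    by (simp add: cyc_N_def hom_b_eq module_hom.sum[OF module_hom_coface] del: sum.atMost_Suc)
  finally show ?thesis ..
qed

end

section \<open>Relations between faces, and vanishing squares of the differentials\<close>

context multiplicative_hom_associative_algebra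
begin

text \<open>Overlapping products, meaning three cyclically adjacent entries, match by
  \<open>hom_assoc\<close>; a product that is twisted afterwards matches by
  \<open>alpha_mult\<close>.\<close>

lemma face_face:
  assumes "length as = n + 3" "i < j" "j \<le> n + 2"
  shows "face i (face j as) = face (j - 1) (face i as)"
proof (rule nth_equalityI)
  show "length (face i (face j as)) = length (face (j - 1) (face i as))"
    using assms by (simp add: length_face)
  fix k assume "k < length (face i (face j as))"
  then have k: "k < n + 1"
    using assms by (simp add: length_face)
  note face_simps = length_face inner_face_nth last_face_nth alpha_mult hom_assoc
  show "face i (face j as) ! k = face (j - 1) (face i as) ! k"
  proof (cases "j = n + 2")
    case last: True
    show ?thesis
    \<comment> \<open>Index n + 1 is an inner face on length n + 3 but the cyclic face on length n +
      2.\<close>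
    proof (cases "i = n + 1")
      case True
      then show ?thesis
        using k assms(1) last by (cases "k = 0") (simp_all add: face_simps)
    next
      case False
      with assms last have "i < n + 1"
        by simp
      then show ?thesis
        using k assms(1) last
        by (cases k i rule: linorder_cases; cases "k = 0") (simp_all add: face_simps)
    qed
  next
    case False
    with assms have j: "j < n + 2"
      by simp
    show ?thesis
    proof (cases k i rule: linorder_cases)
      case less
      then show ?thesis
        using k assms(1,2) j by (simp add: face_simps)
    next
      case equal
      then show ?thesis
        using k assms(1,2) j by (cases "j = Suc i") (simp_all add: face_simps)
    next
      case greater
      show ?thesis
      \<comment> \<open>After face i, the product formed by face j sits at position j - 1.\<close>
      proof (cases "j = Suc k")
        case True
        then show ?thesis
          using greater k assms(1,2) j by (simp add: face_simps)
      next
        case False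
        then have "j < Suc k \<or> Suc k < j"
          by linarith
        then show ?thesis
          using greater k assms(1,2) j by (elim disjE) (simp_all add: face_simps)
      qed
    qed
  qed
qed

text \<open>Pullback reverses composition, so the outer index is the face applied first; the sign
  flips as j drops to j - 1.\<close>

lemma coface_coface:
  assumes "i < j" "j \<le> n + 2"
  shows "coface (Suc n) j (coface n i \<phi>) = - coface (Suc n) i (coface n (j - 1) \<phi>)"
proof -
  obtain j' where "j = Suc j'"
    using assms by (cases j) auto
  then show ?thesis
    using assms by (auto simp: coface_def fun_eq_iff length_face face_face)
qed

text \<open>Terms with i < j cancel those with j \<le> i. The choice \<open>m = n\<close> gives the
  square of \<open>hom_b'\<close>, \<open>m = Suc n\<close> that of \<open>hom_b\<close>.\<close>

lemma sum_coface_coface: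
  assumes "m \<le> Suc n"
  shows "(\<Sum>j\<le>Suc m. coface (Suc n) j (\<Sum>i\<le>m. coface n i \<phi>)) = 0"
proof -
  let ?f = "\<lambda>(j, i). coface (Suc n) j (coface n i \<phi>)"
  let ?A = "{(j, i). i < j \<and> j \<le> Suc m}" and ?B = "{(j, i). j \<le> i \<and> i \<le> m}"
  have fin: "finite ?A" "finite ?B"
    by (rule finite_subset[of _ "{..Suc m} \<times> {..Suc m}"]; auto)+
  have "(\<Sum>j\<le>Suc m. coface (Suc n) j (\<Sum>i\<le>m. coface n i \<phi>)) = sum ?f ({..Suc m} \<times> {..m})"
    by (simp add: module_hom.sum[OF module_hom_coface] sum.cartesian_product del: sum.atMost_Suc)
  also have "{..Suc m} \<times> {..m} = ?A \<union> ?B"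
    by auto
  also have "sum ?f (?A \<union> ?B) = sum ?f ?A + sum ?f ?B"
    using fin by (intro sum.union_disjoint) auto
  also have "sum ?f ?A = (\<Sum>x\<in>?B. - ?f x)"
    using assms
    by (intro sum.reindex_bij_witness[where j = "\<lambda>(j, i). (i, j - 1)" and i = "\<lambda>(i, j). (Suc j, i)"])
      (auto simp: coface_coface)
  finally show ?thesis
    by (simp add: sum_negf del: sum.atMost_Suc plus_fun_apply zero_fun_apply uminus_apply)
qed

lemma hom_b'_hom_b': "\<phi> \<in> cochains scale n \<Longrightarrow> hom_b' mu \<alpha> (Suc n) (hom_b' mu \<alpha> n \<phi>) = 0"
  unfolding hom_b'_eq by (rule sum_coface_coface) simp

lemma hom_b_hom_b: "\<phi> \<in> cochains scale n \<Longrightarrow> hom_b mu \<alpha> (Suc n) (hom_b mu \<alpha> n \<phi>) = 0"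
  unfolding hom_b_eq by (rule sum_coface_coface) simp

end

section \<open>The cocyclic bicomplex as a bicomplex with exact rows\<close>

theorem proposition4p5:
  fixes scale :: "'k::field_char_0 \<Rightarrow> 'a::ab_group_add \<Rightarrow> 'a"
    and mu :: "'a \<Rightarrow> 'a \<Rightarrow> 'a"
    and \<alpha> :: "'a \<Rightarrow> 'a"
    and n :: nat
  assumes "multiplicative_hom_associative_algebra scale mu \<alpha>"
  shows "vspace_isomorphic (HC_lambda scale mu \<alpha> n) (HC scale mu \<alpha> n)"
proof -
  interpret A: multiplicative_hom_associative_algebra scale mu \<alpha>
    by fact
  note vs = A.vector_space_axioms
  interpret CC: row_exact_bicomplex scale_cochain "\<lambda>p q. cochains scale q" CC_hor "CC_ver mu \<alpha>"
  proof (intro row_exact_bicomplex.intro row_exact_bicomplex_axioms.intro cochain.module_axioms)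
    fix p q :: nat
    show "cochain.subspace (cochains scale q)"
      by (rule subspace_cochains[OF vs])
    show "module_hom scale_cochain scale_cochain (CC_hor p q :: ('a list \<Rightarrow> 'k) \<Rightarrow> _)"
    proof (cases "even p")
      case True
      then show ?thesis
        using module_pair.module_hom_sub[OF module_pair.intro cochain.module_hom_ident module_hom_cyc_t]
        by (simp add: CC_hor_def[abs_def] cochain.module_axioms del: minus_apply)
    next
      case False
      then show ?thesis
        using module_hom_cyc_N by (simp add: CC_hor_def[abs_def])
    qed
    show "module_hom scale_cochain scale_cochain (CC_ver mu \<alpha> p q :: ('a list \<Rightarrow> 'k) \<Rightarrow> _)"
    proof (cases "even p")
      case True
      then show ?thesis
        using A.module_hom_hom_b by (simp add: CC_ver_def[abs_def])
    next
      case False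
      then show ?thesis
        using module_pair.module_hom_neg[OF module_pair.intro A.module_hom_hom_b']
        by (simp add: CC_ver_def[abs_def] cochain.module_axioms del: uminus_apply)
    qed
    fix \<phi> :: "'a list \<Rightarrow> 'k" assume \<phi>: "\<phi> \<in> cochains scale q"
    show "CC_hor p q \<phi> \<in> cochains scale q"
      using cochain.subspace_diff[OF subspace_cochains[OF vs] \<phi> cyc_t_in_cochains[OF \<phi>]]
        cyc_N_in_cochains[OF vs \<phi>]
      unfolding CC_hor_def by (cases "even p") simp_all
    show "CC_ver mu \<alpha> p q \<phi> \<in> cochains scale (Suc q)"
      using A.hom_b_in_cochains[OF \<phi>]
        cochain.subspace_neg[OF subspace_cochains[OF vs] A.hom_b'_in_cochains[OF \<phi>]]
      unfolding CC_ver_def by (cases "even p") simp_all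
    show "CC_hor (Suc p) q (CC_hor p q \<phi>) = 0"
      by (simp add: CC_hor_def module_hom.diff[OF module_hom_cyc_N] cyc_N_cyc_t[OF \<phi>]
          cyc_t_cyc_N[OF \<phi>] del: zero_fun_apply minus_apply)
    show "CC_ver mu \<alpha> p (Suc q) (CC_ver mu \<alpha> p q \<phi>) = 0"
      by (simp add: CC_ver_def module_hom.neg[OF A.module_hom_hom_b'] A.hom_b_hom_b[OF \<phi>]
          A.hom_b'_hom_b'[OF \<phi>] del: zero_fun_apply uminus_apply)
    \<comment> \<open>The minus sign in odd columns turns (Id - t) b = b' (Id - t) and b N = N b'
      into anticommutation.\<close>
    show "CC_hor p (Suc q) (CC_ver mu \<alpha> p q \<phi>) + CC_ver mu \<alpha> (Suc p) q (CC_hor p q \<phi>) = 0"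
      by (simp add: CC_hor_def CC_ver_def A.hom_b_cyc_t A.hom_b_cyc_N
          module_hom.neg[OF module_hom_cyc_N]
          del: zero_fun_apply uminus_apply minus_apply plus_fun_apply)
    \<comment> \<open>For even p the kernel of N is the image of Id - t; for odd p the fixed
      cochains are the image of N.\<close>
    show "\<exists>\<psi>\<in>cochains scale q. \<phi> = CC_hor p q \<psi>" if "CC_hor (Suc p) q \<phi> = 0"
      using that cyc_N_zero_imp_range_cyc_t[OF vs \<phi>] cyc_t_fixed_imp_range_cyc_N[OF vs \<phi>]
      by (cases "even p") (simp_all add: CC_hor_def del: minus_apply)
  qed
  \<comment> \<open>The cyclic complex is literally the row kernel in column 0, with
    \<open>hom_b\<close> as its vertical map.\<close>
  have "cyclic_cochains scale = CC.edge"
    by (simp add: cyclic_cochains_def[abs_def] CC_hor_def)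
  moreover have "(hom_b mu \<alpha> :: nat \<Rightarrow> ('a list \<Rightarrow> 'k) \<Rightarrow> _) = CC_ver mu \<alpha> 0"
    by (simp add: CC_ver_def fun_eq_iff)
  ultimately show ?thesis
    using CC.edge_cohomology[of n] unfolding HC_lambda_def HC_def by simp
qed

end
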